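(* Let $w$ be a nonempty word over $\{0,1\}$. Then $w$ is a standard word if and only if its reversal is a type I solution. In other words, $w$ is a standard word if and only if its reversal is a solution and $\gcd(|w|,|w|_1)=1$.
   Context: Words are over $\{0,1\}$; $|w|$ is the length of $w$ and $|w|_1$ is the number of occurrences of the letter $1$ in $w$. The reversal of a word is the word read from right to left. Standard words: for a sequence $(d_k)_{k\ge1}$ of positive integers put $s_{-1}=1$, $s_0=0$, $s_1=s_0^{d_1-1}s_{-1}$, and $s_k=s_{k-1}^{d_k}s_{k-2}$ for $k\ge2$. All words $s_k$ ($k\ge-1$) obtained in this way, from all such sequences, are called standard words. A reversed standard word is the reversal of a standard word. Minimal square roots: for integers $\mathfrak a\ge1$, $\mathfrak b\ge0$ let $S_1=0$, $S_2=010^{\mathfrak a-1}$, $S_3=010^{\mathfrak a}$, $S_4=10^{\mathfrak a}$, $S_5=10^{\mathfrak a+1}(10^{\mathfrak a})^{\mathfrak b}$, $S_6=10^{\mathfrak a+1}(10^{\mathfrak a})^{\mathfrak b+1}$. Let $\mathcal L(\mathfrak a,\mathfrak b)$ be the set of all finite factors of infinite concatenations of the words $S_5$ and $S_6$. Let $\Pi(\mathfrak a,\mathfrak b)$ be the set of nonempty words in $\mathcal L(\mathfrak a,\mathfrak b)$ that are products $X_1^2\cdots X_n^2$ with all $X_i\in\{S_1,\dots,S_6\}$. A nonempty word $v$ is a solution with parameters $(\mathfrak a,\mathfrak b)$ if $v^2\in\Pi(\mathfrak a,\mathfrak b)$ and $v$ can be written as $v=X_1\cdots X_n$ with $X_i\in\{S_1,\dots,S_6\}$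 such that $X_1^2\cdots X_n^2=(X_1\cdots X_n)^2$. Convention: a word $v$ is called a solution if, for some integers $\mathfrak a\ge1$, $\mathfrak b\ge0$, either $v$ or the word obtained from $v$ by exchanging the letters $0$ and $1$ is a solution with parameters $(\mathfrak a,\mathfrak b)$. A type I solution is a solution that is a reversed standard word. *)

theory Defs
  imports Main "HOL-Library.Stream"
begin

text \<open>The letters \<open>0\<close> and \<open>1\<close> are rendered as \<open>False\<close> and \<open>True\<close>.\<close>

type_synonym binword = "bool list"

definition wpow :: "binword \<Rightarrow> nat \<Rightarrow> binword" where
  "wpow w n = concat (replicate n w)"

definition ones :: "binword \<Rightarrow> nat" where
  "ones w = count_list w True"

text \<open>Indices are shifted by one: \<open>std_seq d n\<close> is \<open>s\<^sub>n\<^sub>-\<^sub>1\<close>, so that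
  \<open>std_seq d 0\<close> is \<open>s\<^sub>-\<^sub>1\<close>. The value \<open>d 0\<close> is never used.\<close>

fun std_seq :: "(nat \<Rightarrow> nat) \<Rightarrow> nat \<Rightarrow> binword" where
  "std_seq d 0 = [True]"
| "std_seq d (Suc 0) = [False]"
| "std_seq d (Suc (Suc 0)) = wpow (std_seq d (Suc 0)) (d 1 - 1) @ std_seq d 0"
| "std_seq d (Suc (Suc (Suc n))) =
     wpow (std_seq d (Suc (Suc n))) (d (Suc (Suc n))) @ std_seq d (Suc n)"

definition standard_word :: "binword \<Rightarrow> bool" where
  "standard_word w \<longleftrightarrow> (\<exists>d n. (\<forall>k\<ge>1. d k \<ge> 1) \<and> w = std_seq d n)"

definition reversed_standard_word :: "binword \<Rightarrow> bool" where
  "reversed_standard_word w \<longleftrightarrow> (\<exists>u. standard_word u \<and> w = rev u)"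

definition S1 :: "binword" where
  "S1 = [False]"

definition S2 :: "nat \<Rightarrow> binword" where
  "S2 a = [False, True] @ replicate (a - 1) False"

definition S3 :: "nat \<Rightarrow> binword" where
  "S3 a = [False, True] @ replicate a False"

definition S4 :: "nat \<Rightarrow> binword" where
  "S4 a = True # replicate a False"

definition S5 :: "nat \<Rightarrow> nat \<Rightarrow> binword" where
  "S5 a b = (True # replicate (a + 1) False) @ wpow (True # replicate a False) b"

definition S6 :: "nat \<Rightarrow> nat \<Rightarrow> binword" where
  "S6 a b = (True # replicate (a + 1) False) @ wpow (True # replicate a False) (b + 1)"

definition minimal_roots :: "nat \<Rightarrow> nat \<Rightarrow> binword set" where
  "minimal_roots a b = {S1, S2 a, S3 a, S4 a, S5 a b, S6 a b}"

text \<open>The infinite concatenations are the streams \<open>flat ws\<close>.\<close>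

definition lang :: "nat \<Rightarrow> nat \<Rightarrow> binword set" where
  "lang a b = {stake m (sdrop i (flat ws)) | m i ws. ws \<in> streams {S5 a b, S6 a b}}"

definition Pi_words :: "nat \<Rightarrow> nat \<Rightarrow> binword set" where
  "Pi_words a b = {w \<in> lang a b. w \<noteq> [] \<and>
     (\<exists>Xs. set Xs \<subseteq> minimal_roots a b \<and> w = concat (map (\<lambda>X. X @ X) Xs))}"

definition solution_with :: "nat \<Rightarrow> nat \<Rightarrow> binword \<Rightarrow> bool" where
  "solution_with a b v \<longleftrightarrow> v \<noteq> [] \<and> v @ v \<in> Pi_words a b \<and>
     (\<exists>Xs. set Xs \<subseteq> minimal_roots a b \<and> v = concat Xs \<and>
           concat (map (\<lambda>X. X @ X) Xs) = concat Xs @ concat Xs)"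

definition solution :: "binword \<Rightarrow> bool" where
  "solution v \<longleftrightarrow> (\<exists>a b. a \<ge> 1 \<and> (solution_with a b v \<or> solution_with a b (map Not v)))"

definition type_I_solution :: "binword \<Rightarrow> bool" where
  "type_I_solution v \<longleftrightarrow> solution v \<and> reversed_standard_word v"

end

theory Submission
  imports Defs
begin

text \<open>Give the letters \<open>1\<close> and \<open>0\<close> of a word \<open>v\<close> the weights \<open>q = |v|\<^sub>0\<close> and \<open>- p = - |v|\<^sub>1\<close>, so that \<open>v\<close>
  has total weight \<open>0\<close>, and call the weight of a prefix its height. Reversed standard words are the
  words with \<open>gcd p q = 1\<close> whose heights lie in \<open>[- p, q]\<close>; equivalently, they code a periodic orbit
  of a rotation, the next letter being \<open>1\<close> iff the current height lies below \<open>0\<close> (or below \<open>1\<close>).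
  If \<open>X\<^sub>1\<^sup>2 \<cdots> X\<^sub>n\<^sup>2 = (X\<^sub>1 \<cdots> X\<^sub>n)\<^sup>2\<close>, then doubling the height of \<open>X\<^sub>1 \<cdots> X\<^sub>i\<close> yields a height
  again, which forces all heights to be bounded by those inside a single minimal root, and these lie in
  \<open>[- p, q]\<close>. Conversely, for a rotation, whenever \<open>2 h\<close> is in its domain, some minimal root \<open>X\<close> is read
  from \<open>h\<close> while \<open>X\<^sup>2\<close> is read from \<open>2 h\<close>; iterating from \<open>h = 0\<close> factorizes the word.\<close>

section \<open>Standard words and two substitutions\<close>

definition zeros :: "binword \<Rightarrow> nat" where
  "zeros w = count_list w False"

text \<open>On standard words this morphism raises \<open>d 1\<close> by one; with the exchange of
  letters it generates all of them from one letter.\<close>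

definition subst01 :: "binword \<Rightarrow> binword" where
  "subst01 w = concat (map (\<lambda>x. if x then [False, True] else [False]) w)"

text \<open>The mirror image of \<open>subst01\<close>, hence the version that acts on reversed
  standard words.\<close>

definition subst10 :: "binword \<Rightarrow> binword" where
  "subst10 w = concat (map (\<lambda>x. if x then [True, False] else [False]) w)"

lemma ones_simps [simp]:
  "ones [] = 0" "ones (x # w) = (if x then Suc (ones w) else ones w)"
  "ones (u @ w) = ones u + ones w" "ones (replicate n False) = 0" "ones (rev w) = ones w"
  "ones (map Not w) = zeros w"
  "zeros [] = 0" "zeros (x # w) = (if x then zeros w else Suc (zeros w))"
  "zeros (u @ w) = zeros u + zeros w" "zeros (replicate n False) = n" "zeros (rev w) = zeros w"
  "zeros (map Not w) = ones w"
proof -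
  show "ones (replicate n False) = 0" "zeros (replicate n False) = n"
    by (induction n) (auto simp: ones_def zeros_def)
  show "ones (map Not w) = zeros w" "zeros (map Not w) = ones w"
    by (induction w) (auto simp: ones_def zeros_def)
qed (simp_all add: ones_def zeros_def)

lemma map_Not_Not: "map Not (map Not w) = w"
  by (induction w) auto

lemma length_eq_ones_zeros: "length w = ones w + zeros w"
  by (induction w) auto

lemma subst01_simps [simp]:
  "subst01 [] = []" "subst01 (x # w) = (if x then [False, True] else [False]) @ subst01 w"
  "subst01 (u @ w) = subst01 u @ subst01 w"
  by (simp_all add: subst01_def)

lemma subst10_simps [simp]:
  "subst10 [] = []" "subst10 (x # w) = (if x then [True, False] else [False]) @ subst10 w"
  "subst10 (u @ w) = subst10 u @ subst10 w"
  by (simp_all add: subst10_def)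

lemma rev_subst10: "rev (subst10 w) = subst01 (rev w)"
  by (induction w) auto

lemma rev_subst01: "rev (subst01 w) = subst10 (rev w)"
  by (induction w) auto

lemma ones_subst10 [simp]: "ones (subst10 w) = ones w"
  by (induction w) auto

lemma zeros_subst10 [simp]: "zeros (subst10 w) = ones w + zeros w"
  by (induction w) auto

lemma wpow_simps [simp]: "wpow w 0 = []" "wpow w (Suc n) = w @ wpow w n"
  by (simp_all add: wpow_def)

lemma wpow_add: "wpow w (m + n) = wpow w m @ wpow w n"
  by (induction m) auto

lemma map_wpow: "map f (wpow w n) = wpow (map f w) n"
  by (induction n) auto

lemma subst01_wpow: "subst01 (wpow w n) = wpow (subst01 w) n"
  by (induction n) auto

lemma std_seq_3: "std_seq d 3 = wpow (std_seq d 2) (d 2) @ [False]"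
  by (simp add: numeral_2_eq_2 numeral_3_eq_3)

text \<open>A morphism respects the recursion; the extra 0 is absorbed by the first exponent. Index
  0 is excluded because \<open>subst01\<close> maps the letter 1 to 01.\<close>

lemma subst01_std_seq:
  assumes "d 1 \<ge> 1" "d' 1 = d 1 + 1" "\<And>k. k \<ge> 2 \<Longrightarrow> d' k = d k" "n \<ge> 1"
  shows "subst01 (std_seq d n) = std_seq d' n"
  using assms(4)
proof (induction n rule: less_induct)
  case (less n)
  consider "n = 1" | "n = 2" | "n = 3" | m where "n = Suc (Suc (Suc m))" "m \<ge> 1"
  proof -
    have "n = 1 \<or> n = 2 \<or> n = 3 \<or> (n = Suc (Suc (Suc (n - 3))) \<and> n - 3 \<ge> 1)"
      using less.prems by arith
    then show thesis using that by blast
  qed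
  then show ?case
  proof cases
    case 2
    have "wpow [False] (d 1 - 1) @ [False, True] = wpow [False] (d 1) @ [True]"
      using assms(1) wpow_add[of "[False]" "d 1 - 1" 1] by simp
    then show ?thesis using 2 assms by (simp add: numeral_2_eq_2 subst01_wpow)
  next
    case 3
    have "subst01 (std_seq d 2) = std_seq d' 2" using less.IH[of 2] 3 by simp
    then show ?thesis using 3 assms(3)[of 2] by (simp add: std_seq_3 subst01_wpow)
  next
    case 4
    have "subst01 (std_seq d (Suc m)) = std_seq d' (Suc m)"
         "subst01 (std_seq d (Suc (Suc m))) = std_seq d' (Suc (Suc m))"
      using less.IH 4 by simp_all
    then show ?thesis using 4 assms by (simp add: subst01_wpow)
  qed simp
qed

text \<open>With \<open>d' 1 = 1\<close> the second sequence starts 1, 0, 1, so the exchanged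
  initial pair sits one index later; \<open>d 1 - 1\<close> becomes its second exponent and the
  others shift.\<close>

lemma map_Not_std_seq:
  assumes "d 1 \<ge> 2" "d' 1 = 1" "d' 2 = d 1 - 1" "\<And>k. k \<ge> 2 \<Longrightarrow> d' (Suc k) = d k" "n \<ge> 1"
  shows "map Not (std_seq d n) = std_seq d' (Suc n)"
  using assms(5)
proof (induction n rule: less_induct)
  case (less n)
  consider "n = 1" | "n = 2" | "n = 3" | m where "n = Suc (Suc (Suc m))" "m \<ge> 1"
  proof -
    have "n = 1 \<or> n = 2 \<or> n = 3 \<or> (n = Suc (Suc (Suc (n - 3))) \<and> n - 3 \<ge> 1)"
      using less.prems by arith
    then show thesis using that by blast
  qed
  then show ?case
  proof cases
    case 1
    then show ?thesis using assms by simp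
  next
    case 2
    then show ?thesis using assms by (simp add: numeral_2_eq_2 map_wpow)
  next
    case 3
    have "map Not (std_seq d 2) = std_seq d' 3" using less.IH[of 2] 3 by (simp add: numeral_3_eq_3)
    then show ?thesis using 3 assms(1,2) assms(4)[of 2]
      by (simp add: numeral_2_eq_2 numeral_3_eq_3 map_wpow)
  next
    case 4
    have "map Not (std_seq d (Suc m)) = std_seq d' (Suc (Suc m))"
         "map Not (std_seq d (Suc (Suc m))) = std_seq d' (Suc (Suc (Suc m)))"
      using less.IH 4 by simp_all
    then show ?thesis using 4 assms(4)[of "Suc (Suc m)"] by (simp add: map_wpow)
  qed
qed

section \<open>Closure of standard words under substitution and letter exchange\<close>

lemma standard_word_letter: "standard_word [x]"
proof -
  have "standard_word (std_seq (\<lambda>_. 1) n)" for n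
    unfolding standard_word_def by (rule exI[of _ "\<lambda>_. 1"]) auto
  from this[of 0] this[of 1] show ?thesis by (cases x) auto
qed

lemma standard_word_subst01:
  assumes "standard_word w"
  shows "standard_word (subst01 w)"
proof -
  obtain d n where d: "\<forall>k\<ge>1. d k \<ge> 1" and w: "w = std_seq d n"
    using assms by (auto simp: standard_word_def)
  show ?thesis
  proof (cases "n = 0")
    case True
    \<comment> \<open>The letter 1 at index 0 becomes 01, which is \<open>s_1\<close> for any
      sequence with \<open>d 1 = 2\<close>.\<close>
    then have "subst01 w = std_seq (\<lambda>_. 2) 2" by (simp add: w numeral_2_eq_2)
    then show ?thesis unfolding standard_word_def by (metis one_le_numeral)
  next
    case False
    have "subst01 w = std_seq (d(1 := d 1 + 1)) n"
      unfolding w using False d by (intro subst01_std_seq) auto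
    moreover have "\<forall>k\<ge>1. (d(1 := d 1 + 1)) k \<ge> 1" using d by auto
    ultimately show ?thesis unfolding standard_word_def by blast
  qed
qed

lemma std_seq_directive_one:
  assumes d: "\<forall>k\<ge>1. d k \<ge> 1" and "d 1 = 1" "n \<ge> 1"
  obtains d' where "\<forall>k\<ge>1. d' k \<ge> 1" "map Not (std_seq d' n) = std_seq d (Suc n)"
proof
  let ?d' = "\<lambda>k. if k = 1 then d 2 + 1 else d (Suc k)"
  show "\<forall>k\<ge>1. ?d' k \<ge> 1" using d by auto
  show "map Not (std_seq ?d' n) = std_seq d (Suc n)"
    using assms by (intro map_Not_std_seq) auto
qed

lemma standard_word_map_Not:
  assumes "standard_word w"
  shows "standard_word (map Not w)"
proof -
  obtain d n where d: "\<forall>k\<ge>1. d k \<ge> 1" and w: "w = std_seq d n"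
    using assms by (auto simp: standard_word_def)
  \<comment> \<open>Exchange prepends a 1 to the directive sequence if \<open>d 1 \<ge> 2\<close>
    and strips the leading 1 if \<open>d 1 = 1\<close>.\<close>
  consider "n = 0" | "n = 1" | "d 1 \<ge> 2" "n \<ge> 1" | m where "d 1 = 1" "n = Suc m" "m \<ge> 1"
  proof -
    have "d 1 \<ge> 1" using d by simp
    then have "n = 0 \<or> n = 1 \<or> (d 1 \<ge> 2 \<and> n \<ge> 1) \<or> (d 1 = 1 \<and> n = Suc (n - 1) \<and> n - 1 \<ge> 1)"
      by arith
    then show thesis using that by blast
  qed
  then show ?thesis
  proof cases
    case 3
    let ?d' = "\<lambda>k. if k = 1 then 1 else if k = 2 then d 1 - 1 else d (k - 1)"
    have "map Not w = std_seq ?d' (Suc n)"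
      unfolding w using 3 by (intro map_Not_std_seq) auto
    moreover have "?d' k \<ge> 1" if "k \<ge> 1" for k
    proof -
      have "d (k - 1) \<ge> 1" if "k \<ge> 2" using d that by (metis One_nat_def Suc_1 diff_le_mono diff_Suc_1)
      then show ?thesis using 3 that by (cases "k = 1"; cases "k = 2") auto
    qed
    ultimately show ?thesis unfolding standard_word_def by (intro exI[of _ ?d'] exI[of _ "Suc n"]) simp
  next
    case 4
    obtain d' where "\<forall>k\<ge>1. d' k \<ge> 1" "map Not (std_seq d' m) = std_seq d (Suc m)"
      using std_seq_directive_one[OF d] 4 by metis
    moreover from this(2)[symmetric] have "map Not w = std_seq d' m"
      by (simp only: w 4(2) map_Not_Not)
    ultimately show ?thesis unfolding standard_word_def by blast
  qed (use standard_word_letter in \<open>simp_all add: w\<close>)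
qed

text \<open>Outer induction on the index, inner on \<open>d 1 - 1\<close>: undoing
  \<open>subst01\<close> lowers \<open>d 1\<close> to 1, then undoing an exchange lowers the
  index.\<close>

lemma standard_word_induct [consumes 1, case_names one exchange subst]:
  assumes "standard_word w" and one: "P [True]"
    and exchange: "\<And>w. P w \<Longrightarrow> P (map Not w)" and subst: "\<And>w. P w \<Longrightarrow> P (subst01 w)"
  shows "P w"
proof -
  have "P (std_seq d n)" if "\<forall>k\<ge>1. d k \<ge> 1" for d n
    using that
  proof (induction n arbitrary: d)
    case 0
    then show ?case using one by simp
  next
    case (Suc n)
    show ?case
    proof (cases "n = 0")
      case True
      then show ?thesis using exchange[OF one] by simp
    next
      case False
      have "P (std_seq d' (Suc n))" if "\<forall>k\<ge>1. d' k \<ge> 1" "d' 1 = Suc e" for d' e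
        using that
      proof (induction e arbitrary: d')
        case 0
        obtain d'' where "\<forall>k\<ge>1. d'' k \<ge> 1" "map Not (std_seq d'' n) = std_seq d' (Suc n)"
          using std_seq_directive_one[of d' n] 0 False by auto
        then show ?case using Suc.IH exchange by metis
      next
        case (Suc e)
        let ?d = "d'(1 := Suc e)"
        have "subst01 (std_seq ?d (Suc n)) = std_seq d' (Suc n)"
          using Suc.prems by (intro subst01_std_seq) auto
        moreover have "P (std_seq ?d (Suc n))" using Suc.prems by (intro Suc.IH) auto
        ultimately show ?case using subst by metis
      qed
      moreover have "d 1 = Suc (d 1 - 1)" using Suc.prems[rule_format, of 1] by simp
      ultimately show ?thesis using Suc.prems by blast
    qed
  qed
  then show ?thesis using assms(1) by (auto simp: standard_word_def)
qed

section \<open>Weighted heights of prefixes\<close>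

fun wt :: "int \<Rightarrow> int \<Rightarrow> binword \<Rightarrow> int" where
  "wt p q [] = 0"
| "wt p q (x # u) = (if x then q else - p) + wt p q u"

fun bounded_from :: "int \<Rightarrow> int \<Rightarrow> int \<Rightarrow> binword \<Rightarrow> bool" where
  "bounded_from p q h [] \<longleftrightarrow> - p \<le> h \<and> h \<le> q"
| "bounded_from p q h (x # w) \<longleftrightarrow>
     - p \<le> h \<and> h \<le> q \<and> bounded_from p q (h + (if x then q else - p)) w"

lemma wt_append [simp]: "wt p q (u @ w) = wt p q u + wt p q w"
  by (induction u) auto

lemma wt_eq: "wt p q w = q * int (ones w) - p * int (zeros w)"
  by (induction w) (auto simp: algebra_simps)

lemma wt_total: "wt (int (ones w)) (int (zeros w)) w = 0"
  by (simp add: wt_eq)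

lemma wt_replicate_False [simp]: "wt p q (replicate k False) = - int k * p"
  by (simp add: wt_eq)

lemma wt_wpow [simp]: "wt p q (wpow w n) = int n * wt p q w"
  by (induction n) (auto simp: algebra_simps)

lemma bounded_from_start: "bounded_from p q h w \<Longrightarrow> - p \<le> h \<and> h \<le> q"
  by (cases w) auto

lemma bounded_from_append:
  "bounded_from p q h (u @ w) \<longleftrightarrow> bounded_from p q h u \<and> bounded_from p q (h + wt p q u) w"
proof (induction u arbitrary: h)
  case Nil
  then show ?case using bounded_from_start[of p q h w] by auto
next
  case (Cons x u)
  show ?case using Cons[of "h + (if x then q else - p)"] by (auto simp: add.assoc)
qed

lemma bounded_from_iff:
  "bounded_from p q h w \<longleftrightarrow> (\<forall>u z. w = u @ z \<longrightarrow> - p \<le> h + wt p q u \<and> h + wt p q u \<le> q)"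
proof (intro iffI allI impI)
  fix u z assume "bounded_from p q h w" "w = u @ z"
  then show "- p \<le> h + wt p q u \<and> h + wt p q u \<le> q"
    using bounded_from_append[of p q h u z] bounded_from_start by blast
next
  assume "\<forall>u z. w = u @ z \<longrightarrow> - p \<le> h + wt p q u \<and> h + wt p q u \<le> q"
  then show "bounded_from p q h w"
  proof (induction w arbitrary: h)
    case (Cons x w)
    have "- p \<le> h + (if x then q else - p) + wt p q u \<and> h + (if x then q else - p) + wt p q u \<le> q"
      if "w = u @ z" for u z
      using Cons.prems[rule_format, of "x # u" z] that by (simp add: add.assoc)
    then have "bounded_from p q (h + (if x then q else - p)) w" by (intro Cons.IH allI impI)
    then show ?case using Cons.prems[rule_format, of "[]" "x # w"] by simp
  qed simp
qed

text \<open>Exchange negates heights and swaps \<open>p\<close> and \<open>q\<close>, turning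
  \<open>[- p, q]\<close> into \<open>[- q, p]\<close>.\<close>

lemma bounded_from_map_Not: "bounded_from q p (- h) (map Not w) \<longleftrightarrow> bounded_from p q h w"
proof (induction w arbitrary: h)
  case (Cons x w)
  show ?case using Cons[of "h + (if x then q else - p)"] by (cases x) (auto simp: algebra_simps)
qed auto

section \<open>Desubstitution of words with bounded heights\<close>

lemma subst10_decode:
  assumes "\<And>u z. w = u @ True # z \<Longrightarrow> \<exists>z'. z = False # z'"
  shows "\<exists>w'. w = subst10 w'"
  using assms
proof (induction w rule: length_induct)
  case (1 w)
  show ?case
  proof (cases w)
    case Nil
    then show ?thesis by (intro exI[of _ "[]"]) simp
  next
    case (Cons x t)
    obtain s where s: "w = (if x then [True, False] else [False]) @ s"
      using 1(2)[of "[]" t] Cons by (cases x) auto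
    have "\<exists>z'. z = False # z'" if "s = u @ True # z" for u z
      using 1(2)[of "(if x then [True, False] else [False]) @ u" z] s that by simp
    moreover have "length s < length w" using s by simp
    ultimately obtain s' where "s = subst10 s'" using 1(1) by blast
    then have "w = subst10 (x # s')" using s by simp
    then show ?thesis ..
  qed
qed

text \<open>A letter \<open>1\<close> is read at height at most \<open>0\<close>, so two of them in a row would start at height at
  most \<open>- q < - p\<close>; a final \<open>1\<close> would start at height exactly \<open>- q\<close>.\<close>

lemma bounded_decode:
  assumes b: "bounded_from (int (ones v)) (int (zeros v)) 0 v" and lt: "ones v < zeros v"
  obtains v' where "v = subst10 v'" "bounded_from (int (ones v')) (int (zeros v')) 0 v'"
proof -
  define p q where "p = int (ones v)" and "q = int (zeros v)"
  have pq: "p < q" "p \<ge> 0" using lt by (simp_all add: p_def q_def)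
  have bd: "- p \<le> wt p q u \<and> wt p q u \<le> q" if "v = u @ z" for u z
    using b[unfolded bounded_from_iff, rule_format, OF that] unfolding p_def q_def by simp
  have "\<exists>z'. z = False # z'" if v: "v = u @ True # z" for u z
  proof (cases z)
    case Nil
    then have "wt p q u = - q" using v wt_total[of v] unfolding p_def q_def by simp
    then show ?thesis using bd[OF v] pq by simp
  next
    case (Cons x z')
    have "wt p q (u @ [True, True]) \<le> q" if "x"
      using bd[of "u @ [True, True]" z'] v Cons that by simp
    then have "\<not> x" using bd[OF v] pq by auto
    then show ?thesis using Cons by simp
  qed
  then obtain v' where v': "v = subst10 v'" using subst10_decode[of v] by blast
  have p': "p = int (ones v')" and q': "q = p + int (zeros v')"
    using v' by (simp_all add: p_def q_def)
  \<comment> \<open>The block 10 weighs \<open>q - p\<close>, the number of zeros of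
    \<open>v'\<close>, so heights at block ends are heights of \<open>v'\<close>.\<close>
  have wt': "wt p q (subst10 u) = wt p (int (zeros v')) u" for u
    unfolding q' by (induction u) auto
  have "- p \<le> wt p (int (zeros v')) u \<and> wt p (int (zeros v')) u \<le> int (zeros v')"
    if "v' = u @ z" for u z
  proof
    show "- p \<le> wt p (int (zeros v')) u"
      using bd[of "subst10 u" "subst10 z"] v' that wt' by simp
    \<comment> \<open>The upper bound drops by \<open>p\<close>: after an encoded 1 the height in
      \<open>v\<close> was \<open>p\<close> larger just before the final 0 of the block 10. An
      encoded 0 only lowers the height.\<close>
    show "wt p (int (zeros v')) u \<le> int (zeros v')"
      using that
    proof (induction u arbitrary: z rule: rev_induct)
      case (snoc x u)
      have "wt p q (subst10 u @ [True]) \<le> q" if x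
        using bd[of "subst10 u @ [True]" "False # subst10 z"] v' snoc.prems that by simp
      then show ?case using snoc.IH[of "x # z"] snoc.prems pq wt'[of u] by auto
    qed simp
  qed
  then have "bounded_from (int (ones v')) (int (zeros v')) 0 v'"
    unfolding bounded_from_iff p' by simp
  then show ?thesis using that v' by blast
qed

text \<open>Euclidean descent on the letter counts: undo \<open>subst10\<close> while zeros prevail,
  exchange letters otherwise. Coprimality makes it stop at a single letter or at a word of length
  two.\<close>

lemma bounded_standard:
  assumes "coprime (ones v) (zeros v)" "bounded_from (int (ones v)) (int (zeros v)) 0 v"
  shows "standard_word (rev v)"
  using assms
proof (induction v rule: length_induct)
  case (1 v)
  \<comment> \<open>Stated for any word of the length of \<open>v\<close>, so that it serves both
    \<open>v\<close> and its exchange.\<close>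
  have step: "standard_word (rev w)"
    if w: "length w = length v" "coprime (ones w) (zeros w)"
      "bounded_from (int (ones w)) (int (zeros w)) 0 w" "ones w < zeros w" for w
  proof (cases "ones w = 0")
    case True
    then have "zeros w = 1" using w(2) by simp
    then have "length w = 1" using True by (simp add: length_eq_ones_zeros)
    then show ?thesis using standard_word_letter by (auto simp: length_Suc_conv)
  next
    case False
    obtain w' where w': "w = subst10 w'" "bounded_from (int (ones w')) (int (zeros w')) 0 w'"
      using bounded_decode[OF w(3,4)] .
    have "coprime (ones w') (ones w' + zeros w')" using w(2) w'(1) by simp
    then have "coprime (ones w') (zeros w')" by (simp add: coprime_iff_gcd_eq_1)
    moreover have "length w' < length v"
      using w(1) w'(1) False by (simp add: length_eq_ones_zeros)
    ultimately have "standard_word (rev w')" using 1 w'(2) by blast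
    then show ?thesis by (simp add: w'(1) rev_subst10 standard_word_subst01)
  qed
  consider "ones v < zeros v" | "zeros v < ones v" | "ones v = zeros v" by linarith
  then show ?case
  proof cases
    case 1
    then show ?thesis using step "1.prems" by blast
  next
    case 2
    have "standard_word (rev (map Not v))"
    proof (rule step)
      show "bounded_from (int (ones (map Not v))) (int (zeros (map Not v))) 0 (map Not v)"
        using bounded_from_map_Not[of _ _ 0] "1.prems"(2) by simp
    qed (use 2 "1.prems" in \<open>simp_all add: coprime_commute\<close>)
    then show ?thesis
      using standard_word_map_Not[of "rev (map Not v)"] by (simp only: rev_map map_Not_Not)
  next
    case 3
    then have "ones v = 1" "zeros v = 1" using "1.prems"(1) by simp_all
    then have "length v = Suc (Suc 0)" by (simp add: length_eq_ones_zeros)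
    then obtain x y where v: "v = [x, y]" by (auto simp: length_Suc_conv)
    then have y: "y = (\<not> x)" using \<open>ones v = 1\<close> by (auto split: if_splits)
    have "standard_word [False, True]"
      using standard_word_subst01[OF standard_word_letter[of True]] by simp
    then have "standard_word [z, \<not> z]" for z
      using standard_word_map_Not[of "[False, True]"] by (cases z) auto
    from this[of "\<not> x"] show ?thesis using v y by simp
  qed
qed

section \<open>The factors of concatenations of \<open>S\<^sub>5\<close> and \<open>S\<^sub>6\<close>\<close>

lemma flat_shift: "[] \<notin> set Xs \<Longrightarrow> flat (Xs @- ws) = concat Xs @- flat ws"
  by (induction Xs) (auto simp: flat_Stream)

lemma S56_nonempty: "X \<in> {S5 a b, S6 a b} \<Longrightarrow> X \<noteq> []"
  by (auto simp: S5_def S6_def)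

text \<open>Trades streams for finite lists: the blocks are nonempty, so \<open>i + m\<close> of
  them cover the first \<open>i + m\<close> letters; conversely a finite product is padded by a
  constant stream.\<close>

lemma lang_iff:
  "w \<in> lang a b \<longleftrightarrow> (\<exists>Xs u z. set Xs \<subseteq> {S5 a b, S6 a b} \<and> concat Xs = u @ w @ z)"
proof
  assume "w \<in> lang a b"
  then obtain m i ws where ws: "ws \<in> streams {S5 a b, S6 a b}" and w: "w = stake m (sdrop i (flat ws))"
    by (auto simp: lang_def)
  define Xs where "Xs = stake (i + m) ws"
  have Xs: "set Xs \<subseteq> {S5 a b, S6 a b}"
    using ws unfolding Xs_def streams_iff_sset
    by (metis Un_upper1 order_trans sset_shift stake_sdrop)
  then have ne: "[] \<notin> set Xs" using S56_nonempty by blast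
  then have "length Xs \<le> length (concat Xs)"
  proof (induction Xs)
    case (Cons X Xs)
    then show ?case by (cases X) auto
  qed simp
  then have len: "i + m \<le> length (concat Xs)" by (simp add: Xs_def)
  have "flat ws = concat Xs @- flat (sdrop (i + m) ws)"
    using flat_shift[OF ne, of "sdrop (i + m) ws"] by (simp add: Xs_def stake_sdrop)
  then have "w = take m (drop i (concat Xs))"
    using len by (simp add: w sdrop_shift stake_shift)
  then have "concat Xs = take i (concat Xs) @ w @ drop m (drop i (concat Xs))"
    by (metis append_take_drop_id)
  then show "\<exists>Xs u z. set Xs \<subseteq> {S5 a b, S6 a b} \<and> concat Xs = u @ w @ z" using Xs by blast
next
  assume "\<exists>Xs u z. set Xs \<subseteq> {S5 a b, S6 a b} \<and> concat Xs = u @ w @ z"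
  then obtain Xs u z where Xs: "set Xs \<subseteq> {S5 a b, S6 a b}" and c: "concat Xs = u @ w @ z" by blast
  let ?ws = "Xs @- sconst (S5 a b)"
  have "?ws \<in> streams {S5 a b, S6 a b}"
    using Xs by (simp add: streams_iff_sset)
  moreover have "flat ?ws = u @- w @- z @- flat (sconst (S5 a b))"
    using Xs S56_nonempty[of "[]"] by (subst flat_shift) (auto simp: c)
  then have "w = stake (length w) (sdrop (length u) (flat ?ws))"
    by (simp add: sdrop_shift stake_shift)
  ultimately show "w \<in> lang a b" unfolding lang_def by blast
qed

text \<open>The marker \<open>m\<close> occurs only at block starts, so each occurrence is a cut
  point. It is used at two levels: for the letter 1 in words, and for \<open>S4 (Suc a)\<close> in
  lists of blocks.\<close>

lemma concat_marker_split:
  assumes "set Xs \<subseteq> range (\<lambda>k. m # replicate k n)" "m \<noteq> n" "concat Xs = u @ m # z"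
  obtains Ys Zs where "Xs = Ys @ Zs" "u = concat Ys" "concat Zs = m # z"
proof -
  have "\<exists>Ys Zs. Xs = Ys @ Zs \<and> u = concat Ys \<and> concat Zs = m # z"
    using assms(1,3)
  proof (induction Xs arbitrary: u)
    case (Cons X Xs)
    obtain k where X: "X = m # replicate k n" using Cons.prems by auto
    show ?case
    proof (cases u)
      case Nil
      then show ?thesis using Cons.prems by (intro exI[of _ "[]"] exI[of _ "X # Xs"]) simp
    next
      case (Cons y u')
      have split: "\<exists>u''. u' = replicate k n @ u'' \<and> s = u'' @ m # z"
        if "replicate k n @ s = u' @ m # z" for s
        using that
      proof (induction k arbitrary: u')
        case (Suc k)
        then show ?case using assms(2) by (cases u') auto
      qed simp
      have "replicate k n @ concat Xs = u' @ m # z" and y: "y = m"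
        using Cons.prems(2) X Cons by simp_all
      then obtain u'' where u'': "u' = replicate k n @ u''" "concat Xs = u'' @ m # z"
        using split by blast
      then obtain Ys Zs where "Xs = Ys @ Zs" "u'' = concat Ys" "concat Zs = m # z"
        using Cons.IH Cons.prems(1) by auto
      then show ?thesis using X u'' y Cons by (intro exI[of _ "X # Ys"] exI[of _ Zs]) simp
    qed
  qed simp
  then show ?thesis using that by blast
qed

section \<open>Two-level block structure of the factors\<close>

lemma S5_block: "S5 a b = S4 (Suc a) @ wpow (S4 a) b"
  by (simp add: S5_def S4_def)

lemma S6_block: "S6 a b = S4 (Suc a) @ wpow (S4 a) (Suc b)"
  by (simp add: S6_def S4_def)

lemma S4_counts [simp]: "ones (S4 a) = 1" "zeros (S4 a) = a"
  by (simp_all add: S4_def)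

lemma counts_wpow [simp]: "ones (wpow w n) = n * ones w" "zeros (wpow w n) = n * zeros w"
  by (induction n) auto

lemma S4_neq [simp]: "S4 (Suc a) \<noteq> S4 a"
proof
  assume "S4 (Suc a) = S4 a"
  then have "zeros (S4 (Suc a)) = zeros (S4 a)" by simp
  then show False by simp
qed

lemma lang_blocks:
  assumes "w \<in> lang a b"
  obtains L u z where "set L \<subseteq> {S. \<exists>k\<in>{b, Suc b}. S = S4 (Suc a) # replicate k (S4 a)}"
    "concat (concat L) = u @ w @ z"
proof -
  obtain Xs u z where Xs: "set Xs \<subseteq> {S5 a b, S6 a b}" and c: "concat Xs = u @ w @ z"
    using assms lang_iff by blast
  define f where "f X = S4 (Suc a) # replicate (if X = S5 a b then b else Suc b) (S4 a)" for X
  have "concat (f X) = X" if "X \<in> {S5 a b, S6 a b}" for X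
    using that by (auto simp: f_def S5_block S6_block wpow_def)
  then have "concat (concat (map f Xs)) = concat Xs"
    using Xs by (induction Xs) auto
  moreover have "set (map f Xs) \<subseteq> {S. \<exists>k\<in>{b, Suc b}. S = S4 (Suc a) # replicate k (S4 a)}"
    unfolding f_def by (simp add: image_subset_iff)
  moreover have "concat (concat (map f Xs)) = u @ w @ z" using calculation(1) c by simp
  ultimately show ?thesis by (intro that)
qed

lemma concat_blocks_split:
  assumes "set Bs \<subseteq> {S4 a, S4 (Suc a)}" "concat Bs = u @ True # z"
  obtains Cs Ds where "Bs = Cs @ Ds" "u = concat Cs" "concat Ds = True # z"
proof (rule concat_marker_split[of Bs True False u z])
  show "set Bs \<subseteq> range (\<lambda>k. True # replicate k False)"
    using assms(1) unfolding S4_def by blast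
qed (use assms(2) that in simp_all)

text \<open>Lets the letter counts determine the numbers of long and short blocks:
  \<open>zeros - a * ones\<close> and \<open>Suc a * ones - zeros\<close>.\<close>

lemma counts_blocks:
  assumes "set Bs \<subseteq> {S4 a, S4 (Suc a)}"
  shows "ones (concat Bs) = count_list Bs (S4 a) + count_list Bs (S4 (Suc a))"
    "zeros (concat Bs) = a * ones (concat Bs) + count_list Bs (S4 (Suc a))"
proof -
  have "ones (concat Bs) = count_list Bs (S4 a) + count_list Bs (S4 (Suc a)) \<and>
    zeros (concat Bs) = a * ones (concat Bs) + count_list Bs (S4 (Suc a))"
    using assms
  proof (induction Bs)
    case (Cons X Bs)
    then show ?case using S4_neq[of a] by (auto simp del: S4_neq)
  qed simp
  then show "ones (concat Bs) = count_list Bs (S4 a) + count_list Bs (S4 (Suc a))"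
    "zeros (concat Bs) = a * ones (concat Bs) + count_list Bs (S4 (Suc a))" by auto
qed

text \<open>A factor that starts with 1 and is followed by 1 begins and ends at block boundaries,
  hence consists of whole blocks.\<close>

lemma lang_blocks_split:
  assumes "w @ True # z \<in> lang a b" "w = True # w'"
  obtains L B1 B2 B3 t
    where "set L \<subseteq> {S. \<exists>k\<in>{b, Suc b}. S = S4 (Suc a) # replicate k (S4 a)}"
      "concat L = B1 @ B2 @ B3" "w = concat B2" "concat B3 = True # z @ t"
      "set B1 \<union> set B2 \<union> set B3 \<subseteq> {S4 a, S4 (Suc a)}"
proof -
  from lang_blocks[OF assms(1)]
  obtain L u t where L: "set L \<subseteq> {S. \<exists>k\<in>{b, Suc b}. S = S4 (Suc a) # replicate k (S4 a)}"
    and c: "concat (concat L) = u @ (w @ True # z) @ t" .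
  have LA: "set (concat L) \<subseteq> {S4 a, S4 (Suc a)}"
  proof
    fix X assume "X \<in> set (concat L)"
    then obtain S where "S \<in> set L" "X \<in> set S" by auto
    moreover from this(1) obtain k where "S = S4 (Suc a) # replicate k (S4 a)" using L by blast
    ultimately show "X \<in> {S4 a, S4 (Suc a)}" by (auto split: if_splits)
  qed
  have "concat (concat L) = u @ True # (w' @ True # z @ t)" using c assms(2) by simp
  from concat_blocks_split[OF LA this]
  obtain B1 Bs where B1: "concat L = B1 @ Bs" and Bs: "concat Bs = True # (w' @ True # z @ t)" .
  have "set Bs \<subseteq> {S4 a, S4 (Suc a)}" using LA B1 by auto
  moreover have "concat Bs = w @ True # (z @ t)" using Bs assms(2) by simp
  ultimately obtain B2 B3 where B2: "Bs = B2 @ B3" "w = concat B2" "concat B3 = True # z @ t"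
    by (rule concat_blocks_split)
  have cL: "concat L = B1 @ B2 @ B3" using B1 B2(1) by simp
  then have "set B1 \<union> set B2 \<union> set B3 \<subseteq> {S4 a, S4 (Suc a)}" using LA by simp
  then show ?thesis by (rule that[OF L cL B2(2,3)])
qed

text \<open>Whole blocks carry \<open>a\<close> or \<open>a + 1\<close> zeros per 1. Applied to a
  conjugate of a solution, this bounds the ratio of its letter counts.\<close>

lemma lang_return_counts:
  assumes "w @ True # z \<in> lang a b" "w = True # w'"
  shows "a * ones w \<le> zeros w" "zeros w \<le> Suc a * ones w"
proof -
  obtain B2 where "w = concat B2" "set B2 \<subseteq> {S4 a, S4 (Suc a)}"
  proof (rule lang_blocks_split[OF assms])
    fix B1 B2 B3 assume "w = concat B2" "set B1 \<union> set B2 \<union> set B3 \<subseteq> {S4 a, S4 (Suc a)}"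
    then show thesis using that[of B2] by simp
  qed
  then show "a * ones w \<le> zeros w" "zeros w \<le> Suc a * ones w"
    using counts_blocks[of B2 a] by simp_all
qed

lemma concat_blocks_hd:
  assumes "set Bs \<subseteq> {S4 a, S4 (Suc a)}" "concat Bs = S4 (Suc a) @ z"
  obtains Cs where "Bs = S4 (Suc a) # Cs"
proof -
  obtain X Cs where Bs: "Bs = X # Cs"
    using assms(2) by (cases Bs) (auto simp: S4_def)
  \<comment> \<open>After a short block the run of \<open>a + 1\<close> zeros would force the next
    block to start with 0.\<close>
  have "X \<noteq> S4 a"
  proof
    assume "X = S4 a"
    then have "concat Cs = False # z"
      using assms(2) Bs by (simp add: S4_def replicate_append_same[symmetric])
    then show False using assms(1) Bs by (cases Cs) (auto simp: S4_def)
  qed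
  then show ?thesis using that Bs assms(1) by auto
qed

text \<open>The same argument one level up: between two long blocks lie whole groups, each with one
  long and at least \<open>b\<close> short blocks. The differences count long and short
  blocks.\<close>

lemma lang_long_return_counts:
  assumes "w @ S4 (Suc a) \<in> lang a b" "w = S4 (Suc a) @ w'"
  shows "b * (zeros w - a * ones w) \<le> Suc a * ones w - zeros w"
proof -
  let ?z = "replicate (Suc a) False"
  have T: "S4 (Suc a) = True # ?z" by (simp add: S4_def)
  have "w @ True # ?z \<in> lang a b" "w = True # (?z @ w')"
    using assms unfolding T by simp_all
  from lang_blocks_split[OF this]
  obtain L B1 B2 B3 t
    where L: "set L \<subseteq> {S. \<exists>k\<in>{b, Suc b}. S = S4 (Suc a) # replicate k (S4 a)}"
      and c: "concat L = B1 @ B2 @ B3" and w: "w = concat B2"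
      and B3': "concat B3 = True # ?z @ t"
      and B: "set B1 \<union> set B2 \<union> set B3 \<subseteq> {S4 a, S4 (Suc a)}" .
  have B3: "concat B3 = S4 (Suc a) @ t" using B3' unfolding T by simp
  obtain C2 where C2: "B2 = S4 (Suc a) # C2"
    using concat_blocks_hd[of B2 a w'] w assms(2) B by (metis Un_subset_iff)
  obtain C3 where C3: "B3 = S4 (Suc a) # C3"
    using concat_blocks_hd[of B3 a t] B3 B by (metis Un_subset_iff)
  have rng: "set M \<subseteq> range (\<lambda>k. S4 (Suc a) # replicate k (S4 a))" if "set M \<subseteq> set L" for M
    using L that by blast
  have "concat L = B1 @ S4 (Suc a) # (C2 @ B3)" using c C2 by simp
  from concat_marker_split[OF rng[OF order_refl] S4_neq this]
  obtain M1 M where M: "L = M1 @ M" "concat M = S4 (Suc a) # C2 @ B3" .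
  have "set M \<subseteq> set L" "concat M = B2 @ S4 (Suc a) # C3" using M C2 C3 by simp_all
  from concat_marker_split[OF rng[OF this(1)] S4_neq this(2)]
  obtain M2 M3 where M2: "M = M2 @ M3" "B2 = concat M2" .
  have "set M2 \<subseteq> {S. \<exists>k\<in>{b, Suc b}. S = S4 (Suc a) # replicate k (S4 a)}"
    using L M(1) M2(1) by auto
  then have "b * count_list (concat M2) (S4 (Suc a)) \<le> count_list (concat M2) (S4 a)"
  proof (induction M2)
    case (Cons S M2)
    obtain k where k: "k \<ge> b" "S = S4 (Suc a) # replicate k (S4 a)"
      using Cons.prems that[of b] that[of "Suc b"] by auto
    have "count_list (replicate k (S4 a)) (S4 (Suc a)) = 0"
      "count_list (replicate k (S4 a)) (S4 a) = k"
      using S4_neq[of a] by (simp_all add: count_list_eq_length_filter del: S4_neq)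
    then show ?case using Cons k S4_neq[of a] by (simp del: S4_neq)
  qed simp
  moreover have "set B2 \<subseteq> {S4 a, S4 (Suc a)}" using B by simp
  note counts_blocks[OF this, folded w]
  moreover from this have "zeros w - a * ones w = count_list B2 (S4 (Suc a))"
    "Suc a * ones w - zeros w = count_list B2 (S4 a)" by simp_all
  ultimately show ?thesis by (simp only: M2(2))
qed

section \<open>Solutions have bounded heights\<close>

text \<open>If the minimal height of \<open>X\<^sub>1 \<cdots> X\<^sub>n\<close> is \<open>y + h\<close>, where \<open>y\<close> is the height at the end of
  \<open>X\<^sub>1 \<cdots> X\<^sub>i\<close> and \<open>h\<close> that of a prefix of \<open>X\<^sub>i\<^sub>+\<^sub>1\<close>, then \<open>2 y + h\<close> is a height of
  \<open>X\<^sub>1\<^sup>2 \<cdots> X\<^sub>n\<^sup>2 = (X\<^sub>1 \<cdots> X\<^sub>n)\<^sup>2\<close>, so \<open>y \<ge> 0\<close> and the minimum is at least \<open>h\<close>.\<close>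

lemma bounded_square_product:
  assumes prod: "concat (map (\<lambda>X. X @ X) Xs) = concat Xs @ concat Xs"
    and zero: "wt p q (concat Xs) = 0"
    and bounded: "\<And>X. X \<in> set Xs \<Longrightarrow> bounded_from p q 0 X"
    and pq: "p \<ge> 0" "q \<ge> 0"
  shows "bounded_from p q 0 (concat Xs)"
proof -
  define v where "v = concat Xs"
  define H where "H = (\<lambda>n. wt p q (take n v)) ` {..length v}"
  have fin: "finite H" "H \<noteq> {}" by (auto simp: H_def)
  have mem: "wt p q u \<in> H" if "v = u @ z" for u z
    unfolding H_def using that by (intro image_eqI[of _ _ "length u"]) auto
  \<comment> \<open>As \<open>v\<close> has weight 0, its second copy in \<open>v @ v\<close>
    repeats the heights of the first.\<close>
  have mem2: "wt p q s \<in> H" if st: "v @ v = s @ t" for s t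
  proof -
    consider r where "v = s @ r" | r where "s = v @ r" "v = r @ t"
      using st by (auto simp: append_eq_append_conv2)
    then show ?thesis
    proof cases
      case 1
      then show ?thesis by (rule mem)
    next
      case 2
      have "wt p q s = wt p q r" using 2(1) zero by (simp only: wt_append v_def)
      then show ?thesis using mem[OF 2(2)] by simp
    qed
  qed
  have prefix_split: "\<exists>Ys X Zs s t. Xs = Ys @ X # Zs \<and> X = s @ t \<and> u = concat Ys @ s"
    if "concat Xs = u @ z" "Xs \<noteq> []" for u z and Xs :: "binword list"
    using that
  proof (induction Xs arbitrary: u)
    case (Cons X Xs)
    show ?case
    proof (cases "length u \<le> length X")
      case True
      then obtain t where "X = u @ t"
        using Cons.prems(1) by (auto simp: append_eq_append_conv2)
      then show ?thesis by (intro exI[of _ "[]"] exI[of _ X] exI[of _ Xs] exI[of _ u] exI[of _ t]) simp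
    next
      case False
      then obtain u' where u': "u = X @ u'" "concat Xs = u' @ z"
        using Cons.prems(1) by (auto simp: append_eq_append_conv2)
      then have "Xs \<noteq> []" using False by auto
      then obtain Ys X' Zs s t where *: "Xs = Ys @ X' # Zs" "X' = s @ t" "u' = concat Ys @ s"
        using Cons.IH u'(2) by blast
      then show ?thesis
        using u'(1)
        by (intro exI[of _ "X # Ys"] exI[of _ X'] exI[of _ Zs] exI[of _ s] exI[of _ t]) simp
    qed
  qed simp
  have split: "\<exists>y h. k = y + h \<and> 2 * y + h \<in> H \<and> - p \<le> h \<and> h \<le> q" if kH: "k \<in> H" for k
  proof (cases "Xs = []")
    case True
    then have "k = 0" using kH by (auto simp: H_def v_def)
    then show ?thesis using kH pq by (intro exI[of _ 0]) simp
  next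
    case False
    obtain n where n: "k = wt p q (take n v)" using kH by (auto simp: H_def)
    have "concat Xs = take n v @ drop n v" by (simp add: v_def)
    from prefix_split[OF this False]
    obtain Ys X Zs s t where *: "Xs = Ys @ X # Zs" "X = s @ t" "take n v = concat Ys @ s"
      by blast
    have "v @ v = (concat (map (\<lambda>X. X @ X) Ys) @ s) @ t @ X @ concat (map (\<lambda>X. X @ X) Zs)"
      using prod * by (simp add: v_def)
    from mem2[OF this] have "wt p q (concat (map (\<lambda>X. X @ X) Ys)) + wt p q s \<in> H" by simp
    moreover have "wt p q (concat (map (\<lambda>X. X @ X) Ys)) = 2 * wt p q (concat Ys)"
      by (induction Ys) auto
    moreover have "- p \<le> wt p q s \<and> wt p q s \<le> q"
      using bounded[of X] * unfolding bounded_from_iff by auto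
    ultimately show ?thesis
      using n * by (intro exI[of _ "wt p q (concat Ys)"] exI[of _ "wt p q s"]) simp
  qed
  have "- p \<le> Min H"
  proof -
    obtain y h where "Min H = y + h" "2 * y + h \<in> H" "- p \<le> h"
      using split[of "Min H"] Min_in[OF fin] by blast
    then show ?thesis using Min_le[OF fin(1), of "2 * y + h"] by linarith
  qed
  \<comment> \<open>Symmetrically, \<open>2 * y + h \<le> Max H\<close> gives
    \<open>y \<le> 0\<close>, so the maximum is at most \<open>h\<close>.\<close>
  moreover have "Max H \<le> q"
  proof -
    obtain y h where "Max H = y + h" "2 * y + h \<in> H" "h \<le> q"
      using split[of "Max H"] Max_in[OF fin] by blast
    then show ?thesis using Max_ge[OF fin(1), of "2 * y + h"] by linarith
  qed
  ultimately have "- p \<le> k \<and> k \<le> q" if "k \<in> H" for k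
    using that Min_le[OF fin(1), of k] Max_ge[OF fin(1), of k] by linarith
  then show ?thesis
    unfolding bounded_from_iff using mem by (simp add: v_def)
qed

section \<open>Heights inside the minimal roots\<close>

lemma bounded_from_replicate:
  assumes "p \<ge> 0" "h \<le> q" "- p \<le> h - int k * p"
  shows "bounded_from p q h (replicate k False)"
  using assms
proof (induction k arbitrary: h)
  case (Suc k)
  have "0 \<le> int k * p" "int k * p \<le> h" using Suc.prems by (simp_all add: algebra_simps)
  then have "0 \<le> h" by linarith
  then show ?case using Suc by (auto simp: algebra_simps)
qed simp

lemma bounded_from_S4:
  assumes "p \<ge> 0" "q \<ge> 0" "- p \<le> h" "h \<le> 0" "- p \<le> h + q - int k * p"
  shows "bounded_from p q h (S4 k)"
  unfolding S4_def using assms bounded_from_replicate[of p "h + q" q k] by simp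

lemma wt_S4 [simp]: "wt p q (S4 k) = q - int k * p"
  by (simp add: S4_def)

text \<open>Each block climbs by \<open>q - int a * p\<close>, so the last of the \<open>n\<close>
  blocks starts highest; its letter 1 stays within \<open>q\<close> if that start is at most
  0.\<close>

lemma bounded_from_S4_power:
  assumes "p \<ge> 0" "q \<ge> 0" "int a * p \<le> q" "- p \<le> h" "h \<le> 0"
    "h + int (n - 1) * (q - int a * p) \<le> 0"
  shows "bounded_from p q h (wpow (S4 a) n)"
  using assms(4-)
proof (induction n arbitrary: h)
  case 0
  then show ?case using assms by simp
next
  case (Suc n)
  have b: "bounded_from p q h (S4 a)"
    using assms(1-3) Suc.prems by (intro bounded_from_S4) auto
  show ?case
  proof (cases n)
    case 0
    then show ?thesis using b by simp
  next
    case (Suc m)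
    have nn: "0 \<le> int m * (q - int a * p)" using assms(3) by simp
    have "h + (q - int a * p) + int m * (q - int a * p) \<le> 0"
      using Suc.prems Suc by (simp add: algebra_simps)
    moreover from this nn have "h + (q - int a * p) \<le> 0" by linarith
    ultimately have "bounded_from p q (h + (q - int a * p)) (wpow (S4 a) n)"
      using Suc.prems Suc assms(3) by (intro Suc.IH) auto
    then show ?thesis using b by (simp add: bounded_from_append)
  qed
qed

lemma bounded_short_roots:
  assumes "a \<ge> 1" "p \<ge> 0" "int a * p \<le> q" "q \<le> int (Suc a) * p"
    and "X \<in> {S1, S2 a, S3 a, S4 a}"
  shows "bounded_from p q 0 X"
proof -
  have q: "q \<ge> 0" using assms(2,3) by (meson mult_nonneg_nonneg of_nat_0_le_iff order_trans)
  have "p \<le> int a * p" using assms(1,2) mult_right_mono[of 1 "int a" p] by simp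
  then have pq: "p \<le> q" using assms(3) by simp
  have "bounded_from p q (q - p) (replicate k False)" if "k = a \<or> k = a - 1" for k
    using that assms(1-3) pq by (intro bounded_from_replicate) (auto simp: algebra_simps)
  moreover have "bounded_from p q q (replicate a False)"
    using assms by (intro bounded_from_replicate) auto
  ultimately show ?thesis
    using assms(2,5) q pq by (auto simp: S1_def S2_def S3_def S4_def)
qed

text \<open>After the long block the height is \<open>q - int (Suc a) * p\<close>; the inequality on
  \<open>b\<close> says that \<open>b\<close> further climbs do not pass 0, so up to
  \<open>b + 1\<close> short blocks fit.\<close>

lemma bounded_long_roots:
  assumes "p \<ge> 0" "int a * p \<le> q" "q \<le> int (Suc a) * p"
    and "int b * (q - int a * p) \<le> int (Suc a) * p - q"
    and "X \<in> {S5 a b, S6 a b}"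
  shows "bounded_from p q 0 X"
proof -
  have q: "q \<ge> 0" using assms(1,2) by (meson mult_nonneg_nonneg of_nat_0_le_iff order_trans)
  have "bounded_from p q 0 (S4 (Suc a) @ wpow (S4 a) n)" if "n = b \<or> n = Suc b" for n
  proof -
    have "int (n - 1) * (q - int a * p) \<le> int b * (q - int a * p)"
      using that assms(2) by (intro mult_right_mono) auto
    then have "bounded_from p q (q - int (Suc a) * p) (wpow (S4 a) n)"
      using q assms by (intro bounded_from_S4_power) (auto simp: algebra_simps)
    moreover have "bounded_from p q 0 (S4 (Suc a))"
      using q assms by (intro bounded_from_S4) (auto simp: algebra_simps)
    ultimately show ?thesis by (simp add: bounded_from_append)
  qed
  then show ?thesis using assms(5) by (auto simp: S5_block S6_block simp del: wpow_simps)
qed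

lemma lang_factor: "u @ w @ z \<in> lang a b \<Longrightarrow> w \<in> lang a b"
  unfolding lang_iff by (metis append_assoc)

lemma solution_with_bounded:
  assumes "a \<ge> 1" "solution_with a b v" "ones v > 0"
  shows "bounded_from (int (ones v)) (int (zeros v)) 0 v"
proof -
  define p q where "p = int (ones v)" and "q = int (zeros v)"
  obtain Xs where Xs: "set Xs \<subseteq> minimal_roots a b" "v = concat Xs"
    "concat (map (\<lambda>X. X @ X) Xs) = concat Xs @ concat Xs"
    and vv: "v @ v \<in> lang a b"
    using assms(2) unfolding solution_with_def Pi_words_def by blast
  have "True \<in> set v" using assms(3) unfolding ones_def by (metis count_notin less_irrefl)
  then obtain u z where v: "v = u @ True # z" by (meson split_list)
  \<comment> \<open>The conjugate of \<open>v\<close> starting at a 1 has the same letter counts and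
    is followed by 1 in \<open>v @ v\<close>.\<close>
  have "u @ ((True # z @ u) @ True # z) @ [] \<in> lang a b" using vv v by simp
  from lang_return_counts[OF lang_factor[OF this] refl]
  have "a * ones v \<le> zeros v" "zeros v \<le> Suc a * ones v" by (simp_all add: v algebra_simps)
  then have "int (a * ones v) \<le> int (zeros v)" "int (zeros v) \<le> int (Suc a * ones v)"
    by (simp_all only: zle_int)
  then have pq: "int a * p \<le> q" "q \<le> int (Suc a) * p" "p \<ge> 0" "q \<ge> 0"
    by (simp_all add: p_def q_def algebra_simps)
  have "bounded_from p q 0 X" if X: "X \<in> set Xs" for X
  proof (cases "X \<in> {S5 a b, S6 a b}")
    case False
    then show ?thesis
      using X Xs(1) pq assms(1) by (intro bounded_short_roots[of a]) (auto simp: minimal_roots_def)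
  next
    case True
    \<comment> \<open>The inequality on \<open>b\<close> comes from a long block in
      \<open>v\<close>, which a root \<open>S5\<close> or \<open>S6\<close> supplies.\<close>
    then obtain t where t: "X = S4 (Suc a) @ t" by (auto simp: S5_block S6_block)
    obtain Ys Zs where "Xs = Ys @ X # Zs" using X by (meson split_list)
    then obtain u z where v: "v = u @ S4 (Suc a) @ z" using Xs(2) t by auto
    define w where "w = S4 (Suc a) @ z @ u"
    have w: "ones w = ones v" "zeros w = zeros v" by (simp_all add: w_def v)
    have "u @ (w @ S4 (Suc a)) @ z \<in> lang a b" using vv v by (simp add: w_def)
    from lang_long_return_counts[OF lang_factor[OF this] w_def]
    have "b * (zeros v - a * ones v) \<le> Suc a * ones v - zeros v" by (simp only: w)
    then have "int (b * (zeros v - a * ones v)) \<le> int (Suc a * ones v - zeros v)"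
      by (simp only: zle_int)
    moreover have "int (zeros v - a * ones v) = q - int a * p"
      using pq by (simp add: p_def q_def nat_int_comparison)
    moreover have "int (Suc a * ones v - zeros v) = int (Suc a) * p - q"
      using pq unfolding p_def q_def by (metis of_nat_diff of_nat_le_iff of_nat_mult)
    ultimately have "int b * (q - int a * p) \<le> int (Suc a) * p - q" by simp
    then show ?thesis using bounded_long_roots[OF pq(3,1,2)] True by blast
  qed
  moreover have "wt p q v = 0" using wt_total by (simp add: p_def q_def)
  ultimately have "bounded_from p q 0 (concat Xs)"
    using Xs pq by (intro bounded_square_product) auto
  then show ?thesis by (simp add: Xs(2) p_def q_def)
qed

lemma solution_with_standard:
  assumes "a \<ge> 1" "solution_with a b v" "coprime (ones v) (zeros v)"
  shows "standard_word (rev v)"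
proof (cases "ones v = 0")
  case True
  then have "zeros v = 1" using assms(3) by simp
  then have "length v = 1" using True by (simp add: length_eq_ones_zeros)
  then show ?thesis using standard_word_letter by (auto simp: length_Suc_conv)
next
  case False
  then show ?thesis using bounded_standard solution_with_bounded assms by blast
qed

lemma coprime_ones_zeros_iff: "gcd (length w) (ones w) = 1 \<longleftrightarrow> coprime (ones w) (zeros w)"
proof -
  have "gcd (length w) (ones w) = gcd (ones w) (zeros w)"
    by (metis gcd.commute gcd_add2 length_eq_ones_zeros)
  then show ?thesis by (simp add: coprime_iff_gcd_eq_1)
qed

lemma solution_standard:
  assumes "solution v" "coprime (ones v) (zeros v)"
  shows "standard_word (rev v)"
proof -
  obtain a b where "a \<ge> 1" "solution_with a b v \<or> solution_with a b (map Not v)"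
    using assms(1) by (auto simp: solution_def)
  then have "standard_word (rev v) \<or> standard_word (rev (map Not v))"
    using solution_with_standard[of a b v] solution_with_standard[of a b "map Not v"] assms(2)
    by (auto simp: coprime_commute)
  then show ?thesis
    using standard_word_map_Not[of "rev (map Not v)"] by (metis map_Not_Not rev_map)
qed

section \<open>Reversed standard words are codings of rotations\<close>

text \<open>A path of the exchange of the intervals \<open>[c - p, c)\<close> and \<open>[c, c + q)\<close>.\<close>

fun reads :: "int \<Rightarrow> int \<Rightarrow> int \<Rightarrow> int \<Rightarrow> binword \<Rightarrow> bool" where
  "reads c p q h [] \<longleftrightarrow> True"
| "reads c p q h (x # w) \<longleftrightarrow> (x \<longleftrightarrow> h < c) \<and> reads c p q (h + (if x then q else - p)) w"

lemma reads_append [simp]: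
  "reads c p q h (u @ w) \<longleftrightarrow> reads c p q h u \<and> reads c p q (h + wt p q u) w"
  by (induction u arbitrary: h) (auto simp: add.assoc)

lemma reads_unique:
  "reads c p q h u \<Longrightarrow> reads c p q h w \<Longrightarrow> length u = length w \<Longrightarrow> u = w"
proof (induction u arbitrary: h w)
  case (Cons x u)
  then show ?case by (cases w) auto
qed simp

lemma reads_prefix:
  assumes "reads c p q h u" "reads c p q h w" "length u \<le> length w"
  obtains z where "w = u @ z"
proof -
  have "reads c p q h (take (length u) w)"
    using assms(2) reads_append[of c p q h "take (length u) w" "drop (length u) w"] by simp
  then have "u = take (length u) w"
    using assms by (intro reads_unique) auto
  then show ?thesis using that by (metis append_take_drop_id)
qed

lemma reads_range:
  assumes "reads c p q h u" "c - p \<le> h" "h < c + q" "p \<ge> 0" "q \<ge> 0"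
  shows "c - p \<le> h + wt p q u" "h + wt p q u < c + q"
proof -
  have "c - p \<le> h + wt p q u \<and> h + wt p q u < c + q"
    using assms
  proof (induction u arbitrary: h)
    case (Cons x u)
    then show ?case using Cons.IH[of "h + (if x then q else - p)"]
      by (cases x) (auto simp: algebra_simps)
  qed simp
  then show "c - p \<le> h + wt p q u" "h + wt p q u < c + q" by auto
qed

text \<open>For integers \<open>h < c\<close> fails exactly when \<open>- h < 1 - c\<close>; hence
  the new threshold.\<close>

lemma reads_map_Not: "reads (1 - c) q p (- h) (map Not u) \<longleftrightarrow> reads c p q h u"
proof (induction u arbitrary: h)
  case (Cons x u)
  show ?case using Cons[of "h + (if x then q else - p)"] by (cases x) (auto simp: algebra_simps)
qed simp

text \<open>Reading 10 climbs by \<open>p + q\<close> to a height at least \<open>c\<close>, then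
  falls by \<open>p\<close>, a net climb of \<open>q\<close>.\<close>

lemma reads_subst10:
  assumes "reads c p q h u" "c - p \<le> h" "h < c + q" "p \<ge> 0" "q \<ge> 0"
  shows "reads c p (p + q) h (subst10 u)"
  using assms
proof (induction u arbitrary: h)
  case (Cons x u)
  then show ?case using Cons.IH[of "h + (if x then q else - p)"]
    by (cases x) (auto simp: algebra_simps)
qed simp

text \<open>The threshold \<open>c\<close> records the first letter of the reversal, 1 for
  \<open>c = 1\<close> and 0 for \<open>c = 0\<close>. Exchange turns \<open>c\<close> into
  \<open>1 - c\<close>, substitution keeps it; the inequalities put height 0 into the
  domain.\<close>

lemma standard_word_reads:
  assumes "standard_word w"
  shows "coprime (ones w) (zeros w) \<and>
    (\<exists>c\<in>{0, 1}. c - int (ones w) \<le> 0 \<and> 0 < c + int (zeros w) \<and>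
      reads c (int (ones w)) (int (zeros w)) 0 (rev w))"
  using assms
proof (induction rule: standard_word_induct)
  case one
  then show ?case by auto
next
  case (exchange w)
  then obtain c :: int where c: "c \<in> {0, 1}" "c - int (ones w) \<le> 0" "0 < c + int (zeros w)"
    "reads c (int (ones w)) (int (zeros w)) 0 (rev w)" by blast
  have "reads (1 - c) (int (zeros w)) (int (ones w)) 0 (rev (map Not w))"
    using c(4) reads_map_Not[of c _ _ 0 "rev w"] by (simp add: rev_map)
  then show ?case
    using c exchange by (intro conjI bexI[of _ "1 - c"]) (auto simp: coprime_commute)
next
  case (subst w)
  then obtain c :: int where c: "c \<in> {0, 1}" "c - int (ones w) \<le> 0" "0 < c + int (zeros w)"
    "reads c (int (ones w)) (int (zeros w)) 0 (rev w)" by blast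
  have rev: "rev (subst01 w) = subst10 (rev w)" by (rule rev_subst01)
  have counts: "ones (subst01 w) = ones w" "zeros (subst01 w) = ones w + zeros w"
    by (metis rev ones_simps(5) ones_subst10, metis rev ones_simps(5,11) zeros_subst10)
  have "coprime (ones w) (ones w + zeros w)"
    using subst by (simp add: coprime_iff_gcd_eq_1)
  moreover have "reads c (int (ones w)) (int (ones w) + int (zeros w)) 0 (subst10 (rev w))"
    using c by (intro reads_subst10) auto
  ultimately show ?case
    using c by (intro conjI bexI[of _ c]) (auto simp: counts rev)
qed

lemma reads_replicate:
  assumes "p \<ge> 0" "c - p \<le> h - int k * p"
  shows "reads c p q h (replicate k False)"
  using assms
proof (induction k arbitrary: h)
  case (Suc k)
  have "0 \<le> int k * p" "c + int k * p \<le> h" using Suc.prems by (simp_all add: algebra_simps)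
  then have "c \<le> h" by linarith
  then show ?case using Suc by (auto simp: algebra_simps)
qed simp

lemma reads_S4:
  assumes "p \<ge> 0" "h < c" "c - p \<le> h + q - int k * p"
  shows "reads c p q h (S4 k)"
  using assms reads_replicate[of p c "h + q" k q] by (simp add: S4_def)

lemma reads_01:
  assumes "p \<ge> 0" "c \<le> h" "h < c + p" "c \<le> h + q - int k * p"
  shows "reads c p q h ([False, True] @ replicate k False)"
  using assms reads_replicate[of p c "h - p + q" k q] by simp

section \<open>Square roots of codings of rotations\<close>

text \<open>Commuting nonempty words form a proper power, whose exponent divides both letter
  counts.\<close>

lemma commuting_not_coprime:
  assumes "z @ t = t @ z" "z \<noteq> []" "t \<noteq> []"
  shows "\<not> coprime (ones (z @ t)) (zeros (z @ t))"
proof -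
  obtain n s where n: "1 < n" "concat (replicate n s) = z @ t"
    using comm_append_is_replicate[OF assms(2,3,1)] by blast
  then have "wpow s n = z @ t" by (simp add: wpow_def)
  then have "ones (z @ t) = n * ones s" "zeros (z @ t) = n * zeros s"
    by (metis counts_wpow(1), metis counts_wpow(2))
  then have "n dvd ones (z @ t)" "n dvd zeros (z @ t)" by simp_all
  then show ?thesis using n(1) by (metis coprime_common_divisor_nat less_irrefl)
qed

lemma coprime_minimal_root:
  assumes "X \<in> minimal_roots a b"
  shows "coprime (ones X) (zeros X)"
proof -
  \<comment> \<open>\<open>S5\<close> and \<open>S6\<close> have \<open>n = b + 1\<close> and
    \<open>n = b + 2\<close> ones, and \<open>a * n + 1\<close> zeros.\<close>
  have "coprime n (a * n + 1)" for n
    by (metis coprime_1_right coprime_iff_gcd_eq_1 gcd_add_mult)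
  from this[of "Suc b"] this[of "Suc (Suc b)"] show ?thesis
    using assms
    by (auto simp: minimal_roots_def S1_def S2_def S3_def S4_def S5_block S6_block algebra_simps)
qed

lemma minimal_root_nonempty: "X \<in> minimal_roots a b \<Longrightarrow> X \<noteq> []"
  by (auto simp: minimal_roots_def S1_def S2_def S3_def S4_def S5_def S6_def)

text \<open>Two Euclidean steps fix the parameters: \<open>y\<close> is the remainder of
  \<open>q\<close> by \<open>p\<close>, with quotient \<open>a\<close>, and \<open>r\<close> that of
  \<open>p\<close> by \<open>y\<close>, with quotient \<open>b + 1\<close>. Reading
  \<open>S4 a\<close> climbs by \<open>y\<close>.\<close>

locale rotation =
  fixes a b :: nat and c p q y r :: int
  assumes a: "a \<ge> 1" and c: "c \<in> {0, 1}" and y: "0 < y" "y < p" and q: "q = int a * p + y"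
    and r: "p = y + int b * y + r" "0 \<le> r" "r < y"
begin

lemma pq: "0 < p" "p < q" "0 \<le> p" "0 \<le> q"
proof -
  show "0 < p" using y by simp
  have "1 * p \<le> int a * p" using a y by (intro mult_right_mono) auto
  then show "p < q" using q y by linarith
  then show "0 \<le> p" "0 \<le> q" using \<open>0 < p\<close> by auto
qed

lemma wt_roots: "q - int a * p = y" "wt p q (S2 a) = y" "wt p q (S3 a) = y - p"
  "wt p q (S5 a b) = - r" "wt p q (S6 a b) = y - r"
  using a q r(1) by (simp_all add: S2_def S3_def S5_block S6_block algebra_simps)

lemma reads_A: "c - p \<le> h + y \<Longrightarrow> h < c \<Longrightarrow> reads c p q h (S4 a)"
  using pq q by (intro reads_S4) auto

lemma reads_A_power:
  assumes "c - p \<le> h" "n = 0 \<or> h + int (n - 1) * y < c"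
  shows "reads c p q h (wpow (S4 a) n)"
  using assms
proof (induction n arbitrary: h)
  case (Suc n)
  have "0 \<le> int n * y" "h + int n * y < c" using Suc.prems y by auto
  then have "reads c p q h (S4 a)" using Suc.prems(1) y by (intro reads_A) linarith+
  moreover have "reads c p q (h + y) (wpow (S4 a) n)"
  proof (rule Suc.IH)
    show "n = 0 \<or> h + y + int (n - 1) * y < c"
      using Suc.prems(2) by (cases n) (auto simp: algebra_simps)
  qed (use Suc.prems(1) y in simp)
  ultimately show ?case by (simp add: wt_roots)
qed simp

text \<open>From \<open>[c - y, c)\<close> the long block leads to
  \<open>h + y - p \<ge> c - p\<close>; the short blocks then start below \<open>c\<close>, the last
  at \<open>h - r - y\<close>.\<close>

lemma reads_S5:
  assumes "h < c" "c \<le> h + y"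
  shows "reads c p q h (S5 a b)"
proof -
  have "reads c p q h (S4 (Suc a))"
    using assms pq q by (intro reads_S4) (auto simp: algebra_simps)
  moreover have "reads c p q (h + y - p) (wpow (S4 a) b)"
  proof (rule reads_A_power)
    show "b = 0 \<or> h + y - p + int (b - 1) * y < c"
      using assms y r by (cases b) (auto simp: algebra_simps)
  qed (use assms in simp)
  moreover have "h + wt p q (S4 (Suc a)) = h + y - p" using q by (simp add: algebra_simps)
  ultimately show ?thesis unfolding S5_block reads_append by (simp only: simp_thms)
qed

lemma S6_eq: "S6 a b = S5 a b @ S4 a"
  using wpow_add[of "S4 a" b 1] by (simp add: S5_block S6_block)

lemma reads_S6:
  assumes "h < c" "c \<le> h + y"
  shows "reads c p q h (S6 a b)"
proof -
  have "reads c p q (h - r) (S4 a)" using assms y r by (intro reads_A) auto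
  then show ?thesis using reads_S5[OF assms] by (simp add: S6_eq wt_roots)
qed

lemma reads_S2:
  assumes "c \<le> h" "h < c + p"
  shows "reads c p q h (S2 a)"
proof -
  have "int a * p = int (a - 1) * p + p" using a by (simp add: algebra_simps)
  then show ?thesis unfolding S2_def using assms pq q y by (intro reads_01) auto
qed

lemma reads_S3:
  assumes "c \<le> h" "h < c + p"
  shows "reads c p q h (S3 a)"
  unfolding S3_def using assms pq q y by (intro reads_01) auto

text \<open>Split by \<open>2 * h\<close>: from \<open>c + p\<close> on take \<open>S1\<close>; on
  \<open>[c, c + p)\<close> take \<open>S3\<close> or \<open>S2\<close>, whichever displacement,
  \<open>y - p\<close> or \<open>y\<close>, stays there; below \<open>c - y\<close> take
  \<open>S4\<close>; on \<open>[c - y, c)\<close> take \<open>S5\<close> or \<open>S6\<close>, with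
  displacement \<open>- r\<close> or \<open>y - r\<close>. As \<open>c\<close> is 0 or 1, doubling
  keeps the side of \<open>c\<close>, so \<open>X\<close> is also read from
  \<open>h\<close>.\<close>

lemma root_exists:
  assumes "c - p \<le> 2 * h" "2 * h < c + q"
  shows "\<exists>X\<in>minimal_roots a b. reads c p q h X \<and> reads c p q (2 * h) (X @ X)"
proof -
  have c01: "c = 0 \<or> c = 1" using c by auto
  consider "c \<le> h" "c + p \<le> 2 * h" | "c \<le> h" "2 * h < c + p" "c + p \<le> 2 * h + y"
    | "c \<le> h" "2 * h + y < c + p" | "h < c" "2 * h + y < c"
    | "h < c" "c \<le> 2 * h + y" "c \<le> 2 * h - r + y" | "h < c" "c \<le> 2 * h + y" "2 * h - r + y < c"
    using y by linarith
  then show ?thesis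
  proof cases
    case 1
    then have "reads c p q h S1" "reads c p q (2 * h) (S1 @ S1)" using pq by (auto simp: S1_def)
    then show ?thesis by (auto simp: minimal_roots_def)
  next
    case 2
    have "reads c p q h (S3 a)" using 2 c01 y by (intro reads_S3) auto
    moreover have "reads c p q (2 * h) (S3 a)" "reads c p q (2 * h + (y - p)) (S3 a)"
      using 2 c01 y by (intro reads_S3; auto)+
    ultimately have "reads c p q h (S3 a) \<and> reads c p q (2 * h) (S3 a @ S3 a)"
      by (simp add: wt_roots)
    then show ?thesis by (auto simp: minimal_roots_def)
  next
    case 3
    have "reads c p q h (S2 a)" using 3 c01 y by (intro reads_S2) auto
    moreover have "reads c p q (2 * h) (S2 a)" "reads c p q (2 * h + y) (S2 a)"
      using 3 c01 y by (intro reads_S2; auto)+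
    ultimately have "reads c p q h (S2 a) \<and> reads c p q (2 * h) (S2 a @ S2 a)"
      by (simp add: wt_roots)
    then show ?thesis by (auto simp: minimal_roots_def)
  next
    case 4
    have "reads c p q h (S4 a)" using 4 c01 y assms by (intro reads_A) auto
    moreover have "reads c p q (2 * h) (S4 a)" "reads c p q (2 * h + y) (S4 a)"
      using 4 c01 y assms by (intro reads_A; auto)+
    ultimately have "reads c p q h (S4 a) \<and> reads c p q (2 * h) (S4 a @ S4 a)"
      by (simp add: wt_roots)
    then show ?thesis by (auto simp: minimal_roots_def)
  next
    case 5
    have "reads c p q h (S5 a b)" using 5 c01 by (intro reads_S5) auto
    moreover have "reads c p q (2 * h) (S5 a b)" "reads c p q (2 * h - r) (S5 a b)"
      using 5 c01 r by (intro reads_S5; auto)+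
    ultimately have "reads c p q h (S5 a b) \<and> reads c p q (2 * h) (S5 a b @ S5 a b)"
      by (simp add: wt_roots)
    then show ?thesis by (auto simp: minimal_roots_def)
  next
    case 6
    have "reads c p q h (S6 a b)" using 6 c01 by (intro reads_S6) auto
    moreover have "reads c p q (2 * h) (S6 a b)" "reads c p q (2 * h + (y - r)) (S6 a b)"
      using 6 c01 r by (intro reads_S6; auto)+
    ultimately have "reads c p q h (S6 a b) \<and> reads c p q (2 * h) (S6 a b @ S6 a b)"
      by (simp add: wt_roots)
    then show ?thesis by (auto simp: minimal_roots_def)
  qed
qed

text \<open>A root that straddles the end of the period reads \<open>z t\<close> from height \<open>h\<close> and, since height
  \<open>2 h\<close> reads its square while \<open>z\<close> leads from \<open>2 h\<close> to \<open>h\<close>, also \<open>t z\<close>; this is impossible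
  as the roots are primitive.\<close>

lemma root_factorization:
  assumes v: "reads c p q 0 (v @ v)" "wt p q v = 0"
    and z: "v = u @ z" "c - p \<le> 2 * wt p q u" "2 * wt p q u < c + q"
  shows "\<exists>Xs. set Xs \<subseteq> minimal_roots a b \<and> z = concat Xs \<and>
    reads c p q (2 * wt p q u) (concat (map (\<lambda>X. X @ X) Xs))"
  using z
proof (induction z arbitrary: u rule: length_induct)
  case (1 z)
  let ?h = "wt p q u"
  show ?case
  proof (cases "z = []")
    case True
    then show ?thesis by (intro exI[of _ "[]"]) simp
  next
    case False
    obtain X where X: "X \<in> minimal_roots a b" "reads c p q ?h X" "reads c p q (2 * ?h) (X @ X)"
      using root_exists "1.prems"(2,3) by blast
    have rz: "reads c p q ?h z" using v(1) "1.prems"(1) by simp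
    have hz: "?h + wt p q z = 0" using v(2) "1.prems"(1) by simp
    show ?thesis
    proof (cases "length X \<le> length z")
      case True
      then obtain z' where z': "z = X @ z'" using reads_prefix[OF X(2) rz] by blast
      let ?u = "u @ X"
      \<comment> \<open>Reading \<open>X @ X\<close> from \<open>2 * ?h\<close> ends at twice the
        new height, which therefore stays in the domain.\<close>
      have "c - p \<le> 2 * ?h + wt p q (X @ X)" "2 * ?h + wt p q (X @ X) < c + q"
        using reads_range[OF X(3)] "1.prems"(2,3) pq by auto
      then have "c - p \<le> 2 * wt p q ?u" "2 * wt p q ?u < c + q" by simp_all
      moreover have "length z' < length z" "v = ?u @ z'"
        using z' minimal_root_nonempty[OF X(1)] "1.prems"(1) by auto
      ultimately obtain Xs where Xs: "set Xs \<subseteq> minimal_roots a b" "z' = concat Xs"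
        "reads c p q (2 * wt p q ?u) (concat (map (\<lambda>X. X @ X) Xs))"
        using "1.IH" by blast
      then show ?thesis
        using X z' by (intro exI[of _ "X # Xs"]) (simp add: algebra_simps)
    next
      case False
      then obtain t where t: "X = z @ t"
        using reads_prefix[OF rz X(2)] by (metis nat_le_linear)
      then have "t \<noteq> []" using False by auto
      have "2 * ?h + wt p q z = ?h" using hz by simp
      moreover have "reads c p q (2 * ?h + wt p q z) (t @ z)" using X(3) t by simp
      ultimately have "reads c p q ?h (t @ z)" by (simp only:)
      then have "z @ t = t @ z" using X(2) t by (intro reads_unique) auto
      then have "\<not> coprime (ones X) (zeros X)"
        using commuting_not_coprime \<open>z \<noteq> []\<close> \<open>t \<noteq> []\<close> t by blast
      then show ?thesis using coprime_minimal_root[OF X(1)] by blast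
    qed
  qed
qed

text \<open>\<open>S5\<close> or \<open>S6\<close>, chosen by \<open>g - r + y < c\<close>, leads
  \<open>[c - y, c)\<close> back to itself, so paths from there are prefixes of products of the
  two.\<close>

lemma reads_S56_prefix:
  assumes "c - y \<le> g" "g < c" "reads c p q g u"
  shows "\<exists>Xs z. set Xs \<subseteq> {S5 a b, S6 a b} \<and> concat Xs = u @ z"
  using assms
proof (induction u arbitrary: g rule: length_induct)
  case (1 u)
  define X where "X = (if g - r + y < c then S6 a b else S5 a b)"
  have X56: "X \<in> {S5 a b, S6 a b}" by (simp add: X_def)
  have X: "reads c p q g X"
    using "1.prems" r(2,3) reads_S5 reads_S6 by (simp add: X_def)
  have g: "c - y \<le> g + wt p q X" "g + wt p q X < c"
    using "1.prems" r(2,3) by (auto simp: X_def wt_roots)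
  show ?case
  proof (cases "length u \<le> length X")
    case True
    then obtain z where "X = u @ z" using reads_prefix[OF "1.prems"(3) X] by blast
    then show ?thesis using X56 by (intro exI[of _ "[X]"] exI[of _ z]) auto
  next
    case False
    then obtain u' where u': "u = X @ u'" using reads_prefix[OF X "1.prems"(3)] by (metis nat_le_linear)
    have "X \<noteq> []" using S56_nonempty by (auto simp: X_def)
    then have "length u' < length u" using u' by simp
    moreover have "reads c p q (g + wt p q X) u'" using "1.prems"(3) u' by simp
    ultimately obtain Xs z where "set Xs \<subseteq> {S5 a b, S6 a b}" "concat Xs = u' @ z"
      using "1.IH" g by blast
    then show ?thesis using u' X56 by (intro exI[of _ "X # Xs"] exI[of _ z]) auto
  qed
qed

lemma reads_lang:
  assumes "reads c p q 0 u"
  shows "u \<in> lang a b"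
proof -
  obtain w g where "c - y \<le> g" "g < c" "reads c p q g (w @ u)"
  \<comment> \<open>Height 0 lies in \<open>[c - y, c)\<close> only for \<open>c = 1\<close>; for
    \<open>c = 0\<close> a prefix \<open>S4 a\<close> read from \<open>- y\<close> leads to
    it.\<close>
  proof (cases "c = 0")
    case True
    have "reads c p q (- y) (S4 a)" using True y by (intro reads_A) auto
    then show ?thesis using that[of "- y" "S4 a"] assms True y by (simp add: wt_roots)
  next
    case False
    then show ?thesis using that[of 0 "[]"] assms c y by simp
  qed
  then obtain Xs z where "set Xs \<subseteq> {S5 a b, S6 a b}" "concat Xs = (w @ u) @ z"
    using reads_S56_prefix by blast
  then show ?thesis unfolding lang_iff by auto
qed

text \<open>The product of squares and \<open>v @ v\<close> are read from the same height and have
  the same length, so they agree.\<close>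

lemma rotation_solution:
  assumes "v \<noteq> []" "reads c p q 0 v" "wt p q v = 0"
  shows "solution_with a b v"
proof -
  have vv: "reads c p q 0 (v @ v)" using assms by simp
  obtain Xs where Xs: "set Xs \<subseteq> minimal_roots a b" "v = concat Xs"
    "reads c p q 0 (concat (map (\<lambda>X. X @ X) Xs))"
    using root_factorization[OF vv assms(3), of "[]" v] c pq by auto
  have "length (concat (map (\<lambda>X. X @ X) Xs)) = length (concat Xs @ concat Xs)"
    by (induction Xs) auto
  then have "concat (map (\<lambda>X. X @ X) Xs) = v @ v"
    using reads_unique[OF Xs(3) vv] Xs(2) by simp
  then show ?thesis
    using Xs(1,2) reads_lang[OF vv] assms(1) unfolding solution_with_def Pi_words_def
    by (metis (mono_tags, lifting) append_is_Nil_conv mem_Collect_eq)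
qed

end

section \<open>Degenerate slopes and assembly of the equivalence\<close>

lemma singleton_solution:
  assumes "X \<in> minimal_roots a b" "X @ X \<in> lang a b"
  shows "solution_with a b X"
proof -
  have "set [X] \<subseteq> minimal_roots a b" "X = concat [X]" "concat (map (\<lambda>X. X @ X) [X]) = concat [X] @ concat [X]"
    using assms(1) by simp_all
  then show ?thesis
    using assms minimal_root_nonempty[OF assms(1)] unfolding solution_with_def Pi_words_def
    by (smt (verit) append_is_Nil_conv mem_Collect_eq)
qed

text \<open>If the first Euclidean division is impossible or exact, \<open>v\<close> is itself a
  minimal root and \<open>b\<close> is chosen so that its square is a factor; otherwise the rotation
  applies.\<close>

lemma solution_with_exists:
  assumes "v \<noteq> []" "coprime (ones v) (zeros v)" "ones v \<le> zeros v" "c \<in> {0, 1}"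
    and reads: "reads c (int (ones v)) (int (zeros v)) 0 v"
  shows "\<exists>a b. a \<ge> 1 \<and> solution_with a b v"
proof -
  define p where "p = ones v"
  define a where "a = zeros v div p"
  define y where "y = zeros v mod p"
  have q: "zeros v = a * p + y" by (simp add: a_def y_def)
  consider "p = 0" | "p > 0" "y = 0" | "p > 0" "y > 0" by blast
  then show ?thesis
  proof cases
    case 1
    then have "zeros v = 1" using assms(2) by (simp add: p_def)
    then have "length v = 1" using 1 by (simp add: length_eq_ones_zeros p_def)
    then have v: "v = S1" using 1 by (auto simp: S1_def p_def length_Suc_conv split: if_splits)
    \<comment> \<open>The word 100 contains the square of \<open>S1\<close>.\<close>
    have "concat [S5 1 0] = [True] @ (v @ v) @ []"
      by (simp add: S5_def v S1_def numeral_2_eq_2)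
    then have "v @ v \<in> lang 1 0" unfolding lang_iff by (metis insertI1 empty_set empty_subsetI insert_subset list.simps(15))
    then have "solution_with 1 0 v" by (intro singleton_solution) (auto simp: v minimal_roots_def)
    then show ?thesis by blast
  next
    case 2
    have "p = 1" using assms(2) 2 q by (simp add: p_def)
    have a: "a \<ge> 1" using assms(3) 2 q by (cases a) (auto simp: p_def)
    \<comment> \<open>For \<open>b = 1\<close> a single \<open>S6\<close> contains the squares of
      both \<open>S4 a\<close> and \<open>S2 a\<close>.\<close>
    have S6: "concat [S6 a 1] = S4 (Suc a) @ S4 a @ S4 a"
      by (simp add: S6_block)
    have "v = S4 a \<or> v = S2 a"
    proof (cases "c = 0")
      case True
      have "reads c (int (ones v)) (int (zeros v)) 0 ([False, True] @ replicate (a - 1) False)"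
        using True a q 2 \<open>p = 1\<close> by (intro reads_01) (auto simp: p_def)
      then have "v = S2 a"
        using reads a q 2 \<open>p = 1\<close>
        by (intro reads_unique) (auto simp: S2_def length_eq_ones_zeros p_def)
      then show ?thesis ..
    next
      case False
      have "reads c (int (ones v)) (int (zeros v)) 0 (S4 a)"
        using False assms(4) q 2 \<open>p = 1\<close> by (intro reads_S4) (auto simp: p_def)
      then have "v = S4 a"
        using reads q 2 \<open>p = 1\<close>
        by (intro reads_unique) (auto simp: S4_def length_eq_ones_zeros p_def)
      then show ?thesis ..
    qed
    then have "v @ v \<in> lang a 1 \<and> v \<in> minimal_roots a 1"
    proof
      assume v: "v = S4 a"
      have "concat [S6 a 1] = S4 (Suc a) @ (v @ v) @ []"
        by (simp only: S6) (simp add: v S4_def)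
      then show ?thesis unfolding lang_iff using v
        by (intro conjI exI[of _ "[S6 a 1]"] exI[of _ "S4 (Suc a)"] exI[of _ "[]"])
          (auto simp: minimal_roots_def)
    next
      assume v: "v = S2 a"
      obtain a' where a': "a = Suc a'" using a by (cases a) auto
      have "concat [S6 a 1] = (True # replicate a False) @ (v @ v) @ [False]"
        by (simp only: S6) (simp add: v S2_def S4_def a' replicate_append_same flip: replicate_Suc)
      then show ?thesis unfolding lang_iff using v
        by (intro conjI exI[of _ "[S6 a 1]"] exI[of _ "True # replicate a False"] exI[of _ "[False]"])
          (auto simp: minimal_roots_def)
    qed
    then show ?thesis using singleton_solution a by blast
  next
    case 3
    have yp: "y < p" using 3 by (simp add: y_def)
    have a: "a \<ge> 1" using assms(3) yp q by (cases a) (auto simp: p_def)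
    \<comment> \<open>The quotient of \<open>p\<close> by \<open>y\<close> is \<open>b + 1\<close>,
      so one \<open>y\<close> is subtracted first.\<close>
    define b where "b = (p - y) div y"
    define r where "r = (p - y) mod y"
    have "p - y = b * y + r" by (simp add: b_def r_def)
    then have p: "p = y + b * y + r" using yp by simp
    have "rotation a b c (int p) (int (zeros v)) (int y) (int r)"
    proof
      show "int (zeros v) = int a * int p + int y" by (simp add: q)
      show "int p = int y + int b * int y + int r" by (subst p) simp
    qed (use a assms(4) 3 yp in \<open>simp_all add: r_def\<close>)
    then have "solution_with a b v"
      using rotation.rotation_solution assms(1) reads wt_total[of v] by (simp add: p_def)
    then show ?thesis using a by blast
  qed
qed

lemma standard_solution:
  assumes "standard_word w"
  shows "solution (rev w)"
proof -
  obtain c :: int where c: "c \<in> {0, 1}" "c - int (ones w) \<le> 0" "0 < c + int (zeros w)"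
    "reads c (int (ones w)) (int (zeros w)) 0 (rev w)" and cop: "coprime (ones w) (zeros w)"
    using standard_word_reads[OF assms] by blast
  have ne: "rev w \<noteq> []" using cop by auto
  show ?thesis
  proof (cases "ones w \<le> zeros w")
    case True
    then have "\<exists>a b. a \<ge> 1 \<and> solution_with a b (rev w)"
      using ne c cop by (intro solution_with_exists) auto
    then show ?thesis by (auto simp: solution_def)
  next
    case False
    have "reads (1 - c) (int (zeros w)) (int (ones w)) 0 (map Not (rev w))"
      using c(4) reads_map_Not[of c _ _ 0 "rev w"] by simp
    then have "\<exists>a b. a \<ge> 1 \<and> solution_with a b (map Not (rev w))"
      using False ne c cop
      by (intro solution_with_exists[of _ "1 - c"]) (auto simp: coprime_commute)
    then show ?thesis by (auto simp: solution_def)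
  qed
qed

theorem theorem1p1:
  fixes w :: binword
  assumes "w \<noteq> []"
  shows "(standard_word w \<longleftrightarrow> type_I_solution (rev w)) \<and>
         (standard_word w \<longleftrightarrow> solution (rev w) \<and> gcd (length w) (ones w) = 1)"
proof
  show "standard_word w \<longleftrightarrow> type_I_solution (rev w)"
    unfolding type_I_solution_def reversed_standard_word_def using standard_solution by auto
  have "standard_word w" if "solution (rev w)" "coprime (ones w) (zeros w)"
    using solution_standard[OF that(1)] that(2) by simp
  then show "standard_word w \<longleftrightarrow> solution (rev w) \<and> gcd (length w) (ones w) = 1"
    unfolding coprime_ones_zeros_iff using standard_solution standard_word_reads by blast
qed

end
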